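(* There is no slender abelian group $G$ such that $\mathbb{Z}^\omega$ and $G$ are $L_{\infty\omega_1}$-equivalent.
   Context: All groups are abelian. $\mathbb{Z}^\omega$ (the Baer-Specker group) is the product of countably many copies of $\mathbb{Z}$. A torsion-free abelian group $G$ is slender if for every homomorphism $h:\mathbb{Z}^\omega\to G$ one has $h(e_n)=0$ for all but finitely many $n\in\mathbb{N}$, where $e_n$ is the standard $n$-th unit vector (a slender group is by definition torsion-free). The vocabulary $L$ of groups consists of a binary function symbol $+$ and a constant symbol $0$. For infinite cardinals $\lambda\le\kappa$, $L_{\kappa\lambda}$ is the smallest collection of formulas containing the atomic $L$-formulas and closed under negation, conjunctions and disjunctions of sets $\{\varphi_\alpha:\alpha<\mu\}$ of formulas with $\mu<\kappa$, and existential and universal quantification over strings of variables of length less than $\lambda$. $L_{\infty\lambda}$ is the union of the $L_{\kappa\lambda}$ as $\kappa$ ranges over all infinite cardinals ($\kappa\ge\lambda$). Here $\omega_1=\aleph_1$. Two groups $A,B$ are $L_{\infty\omega_1}$-equivalent if for every $L_{\infty\omega_1}$-sentence $\varphi$, $\varphi$ holds in $A$ if and only if $\varphi$ holds in $B$. *)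

theory Defs
  imports "HOL-Algebra.Product_Groups" "HOL-Library.Countable_Set_Type"
begin

unbundle cardinal_syntax

section \<open>Slender groups\<close>

text \<open>
  Abelian groups are the commutative groups of HOL-Algebra, so \<open>+\<close> and \<open>0\<close> appear as
  \<open>\<otimes>\<close> and \<open>\<one>\<close>, and \<open>n x\<close> as \<open>x [^] n\<close>.
\<close>

definition baer_specker :: "(nat \<Rightarrow> int) monoid"
  where "baer_specker = product_group UNIV (\<lambda>_. integer_group)"

definition unit_vector :: "nat \<Rightarrow> nat \<Rightarrow> int"
  where "unit_vector n = (\<lambda>i. if i = n then 1 else 0)"

definition torsion_free_group :: "('a, 'm) monoid_scheme \<Rightarrow> bool"
  where "torsion_free_group G \<longleftrightarrow>
    (\<forall>x\<in>carrier G. \<forall>n::nat. n > 0 \<longrightarrow> x [^]\<^bsub>G\<^esub> n = \<one>\<^bsub>G\<^esub> \<longrightarrow> x = \<one>\<^bsub>G\<^esub>)"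

definition slender :: "('a, 'm) monoid_scheme \<Rightarrow> bool"
  where "slender G \<longleftrightarrow> comm_group G \<and> torsion_free_group G \<and>
    (\<forall>h\<in>hom baer_specker G. finite {n. h (unit_vector n) \<noteq> \<one>\<^bsub>G\<^esub>})"


section \<open>Infinitary formulas\<close>

datatype 'v trm = Var 'v | Zero | Plus "'v trm" "'v trm"

text \<open>
  \<open>Conj I F\<close> and \<open>Disj I F\<close> are the conjunction and disjunction of the set of all \<open>F i\<close> with
  \<open>i \<in> I\<close>; the values of \<open>F\<close> outside \<open>I\<close> play no role. \<open>Exists Y\<close> and \<open>Forall Y\<close> quantify
  simultaneously over all variables in \<open>Y\<close>, the set of entries of a string of variables.
\<close>

datatype ('v, 'i) formula =
    Eq "'v trm" "'v trm"
  | Neg "('v, 'i) formula"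
  | Conj "'i set" "'i \<Rightarrow> ('v, 'i) formula"
  | Disj "'i set" "'i \<Rightarrow> ('v, 'i) formula"
  | Exists "'v set" "('v, 'i) formula"
  | Forall "'v set" "('v, 'i) formula"

primrec in_L :: "'k rel \<Rightarrow> 'l rel \<Rightarrow> ('v, 'i) formula \<Rightarrow> bool" where
  "in_L \<kappa> \<mu> (Eq s t) \<longleftrightarrow> True"
| "in_L \<kappa> \<mu> (Neg \<phi>) \<longleftrightarrow> in_L \<kappa> \<mu> \<phi>"
| "in_L \<kappa> \<mu> (Conj I F) \<longleftrightarrow> |I| <o \<kappa> \<and> (\<forall>i\<in>I. in_L \<kappa> \<mu> (F i))"
| "in_L \<kappa> \<mu> (Disj I F) \<longleftrightarrow> |I| <o \<kappa> \<and> (\<forall>i\<in>I. in_L \<kappa> \<mu> (F i))"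
| "in_L \<kappa> \<mu> (Exists Y \<phi>) \<longleftrightarrow> |Y| <o \<mu> \<and> in_L \<kappa> \<mu> \<phi>"
| "in_L \<kappa> \<mu> (Forall Y \<phi>) \<longleftrightarrow> |Y| <o \<mu> \<and> in_L \<kappa> \<mu> \<phi>"

text \<open>
  The cardinals available on the type \<open>('i + 'l) set\<close> include one that is above \<open>\<mu>\<close> and strictly
  above the cardinality of \<open>'i\<close>, so the union below is over sufficiently many \<open>\<kappa>\<close>.
\<close>

definition in_L_infinity :: "'l rel \<Rightarrow> ('v, 'i) formula \<Rightarrow> bool"
  where "in_L_infinity \<mu> \<phi> \<longleftrightarrow>
    (\<exists>\<kappa> :: ('i + 'l) set rel. Cinfinite \<kappa> \<and> \<mu> \<le>o \<kappa> \<and> in_L \<kappa> \<mu> \<phi>)"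

definition omega_1 :: "nat set rel"
  where "omega_1 = cardSuc natLeq"

primrec trm_vars :: "'v trm \<Rightarrow> 'v set" where
  "trm_vars (Var v) = {v}"
| "trm_vars Zero = {}"
| "trm_vars (Plus s t) = trm_vars s \<union> trm_vars t"

primrec free_vars :: "('v, 'i) formula \<Rightarrow> 'v set" where
  "free_vars (Eq s t) = trm_vars s \<union> trm_vars t"
| "free_vars (Neg \<phi>) = free_vars \<phi>"
| "free_vars (Conj I F) = (\<Union>i\<in>I. free_vars (F i))"
| "free_vars (Disj I F) = (\<Union>i\<in>I. free_vars (F i))"
| "free_vars (Exists Y \<phi>) = free_vars \<phi> - Y"
| "free_vars (Forall Y \<phi>) = free_vars \<phi> - Y"

primrec trm_val :: "('a, 'm) monoid_scheme \<Rightarrow> ('v \<Rightarrow> 'a) \<Rightarrow> 'v trm \<Rightarrow> 'a" where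
  "trm_val A e (Var v) = e v"
| "trm_val A e Zero = \<one>\<^bsub>A\<^esub>"
| "trm_val A e (Plus s t) = trm_val A e s \<otimes>\<^bsub>A\<^esub> trm_val A e t"

primrec sat :: "('a, 'm) monoid_scheme \<Rightarrow> ('v, 'i) formula \<Rightarrow> ('v \<Rightarrow> 'a) \<Rightarrow> bool" where
  "sat A (Eq s t) = (\<lambda>e. trm_val A e s = trm_val A e t)"
| "sat A (Neg \<phi>) = (\<lambda>e. \<not> sat A \<phi> e)"
| "sat A (Conj I F) = (\<lambda>e. \<forall>i\<in>I. sat A (F i) e)"
| "sat A (Disj I F) = (\<lambda>e. \<exists>i\<in>I. sat A (F i) e)"
| "sat A (Exists Y \<phi>) = (\<lambda>e. \<exists>d\<in>Y \<rightarrow> carrier A. sat A \<phi> (override_on e d Y))"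
| "sat A (Forall Y \<phi>) = (\<lambda>e. \<forall>d\<in>Y \<rightarrow> carrier A. sat A \<phi> (override_on e d Y))"

definition holds :: "('a, 'm) monoid_scheme \<Rightarrow> ('v, 'i) formula \<Rightarrow> bool"
  where "holds A \<phi> \<longleftrightarrow> (\<forall>e\<in>UNIV \<rightarrow> carrier A. sat A \<phi> e)"


section \<open>Equivalence for infinitary sentences\<close>

text \<open>
  HOL cannot quantify over all index types of conjunctions at once. For two fixed structures with
  elements in \<open>'a\<close> and \<open>'b\<close> this is not needed: a formula matters only through the pair
  of relations that it defines in the two structures, so the set of such pairs can index all
  conjunctions. Likewise countably many variables suffice, because only
  countably many variables are free in a subformula of a sentence with countable
  quantifier strings. The theorem \<open>equiv_L_infinity_omega_1_all_types\<close> below makes this precise: the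
  relation defined here implies (and hence is) agreement on the sentences over arbitrary
  types of variables and of indices.
\<close>

type_synonym ('a, 'b) joint_index = "(nat \<Rightarrow> 'a) set \<times> (nat \<Rightarrow> 'b) set"

definition equiv_L_infinity_omega_1 :: "('a, 'm) monoid_scheme \<Rightarrow> ('b, 'n) monoid_scheme \<Rightarrow> bool"
  where "equiv_L_infinity_omega_1 A B \<longleftrightarrow>
    (\<forall>\<phi> :: (nat, ('a, 'b) joint_index) formula.
       in_L_infinity omega_1 \<phi> \<and> free_vars \<phi> = {} \<longrightarrow> (holds A \<phi> \<longleftrightarrow> holds B \<phi>))"

lemma less_omega_1_iff: "|Y| <o omega_1 \<longleftrightarrow> countable Y"
  unfolding omega_1_def countable_card_le_natLeq
  by (rule cardSuc_ordLeq_ordLess[OF natLeq_Card_order card_of_Card_order])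

primrec countable_strings :: "('v, 'i) formula \<Rightarrow> bool" where
  "countable_strings (Eq s t) \<longleftrightarrow> True"
| "countable_strings (Neg \<phi>) \<longleftrightarrow> countable_strings \<phi>"
| "countable_strings (Conj I F) \<longleftrightarrow> (\<forall>i\<in>I. countable_strings (F i))"
| "countable_strings (Disj I F) \<longleftrightarrow> (\<forall>i\<in>I. countable_strings (F i))"
| "countable_strings (Exists Y \<phi>) \<longleftrightarrow> countable Y \<and> countable_strings \<phi>"
| "countable_strings (Forall Y \<phi>) \<longleftrightarrow> countable Y \<and> countable_strings \<phi>"

lemma in_L_omega_1_iff:
  fixes \<phi> :: "('v, 'i) formula"
  assumes "|UNIV :: 'i set| <o \<kappa>"
  shows "in_L \<kappa> omega_1 \<phi> \<longleftrightarrow> countable_strings \<phi>"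
proof -
  have "|I| <o \<kappa>" for I :: "'i set"
    using assms card_of_mono1[of I UNIV] ordLeq_ordLess_trans by blast
  then show ?thesis by (induction \<phi>) (auto simp: less_omega_1_iff)
qed

lemma in_L_imp_countable_strings: "in_L \<kappa> omega_1 \<phi> \<Longrightarrow> countable_strings \<phi>"
  by (induction \<phi>) (auto simp: less_omega_1_iff)

lemma in_L_infinity_omega_1_iff: "in_L_infinity omega_1 \<phi> \<longleftrightarrow> countable_strings \<phi>"
  for \<phi> :: "('v, 'i) formula"
proof
  assume *: "countable_strings \<phi>"
  let ?\<kappa> = "|UNIV :: ('i + nat set) set set|"
  have "|UNIV :: 'i set| \<le>o |UNIV :: ('i + nat set) set|"
    by (rule card_of_ordLeqI[of Inl]) auto
  moreover have less: "|UNIV :: ('i + nat set) set| <o ?\<kappa>"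
    using card_of_Pow[of "UNIV :: ('i + nat set) set"] by simp
  ultimately have L: "in_L ?\<kappa> omega_1 \<phi>"
    using * in_L_omega_1_iff ordLeq_ordLess_trans by blast
  have "|UNIV :: nat set set| \<le>o ?\<kappa>"
    by (rule card_of_ordLeqI[of "\<lambda>x. {Inr x}"]) (auto simp: inj_on_def)
  moreover have "natLeq <o |UNIV :: nat set set|"
    using ordIso_ordLess_trans[OF ordIso_symmetric[OF card_of_nat]] card_of_Pow[of "UNIV :: nat set"]
    by simp
  ultimately have "natLeq <o ?\<kappa>"
    by (metis ordLess_ordLeq_trans)
  then have "omega_1 \<le>o ?\<kappa>"
    unfolding omega_1_def
    by (rule cardSuc_least[OF natLeq_Card_order card_of_Card_order])
  moreover have "infinite (UNIV :: ('i + nat set) set set)"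
    by (simp add: Finite_Set.finite_set)
  then have "Cinfinite ?\<kappa>"
    by (simp add: cinfinite_def card_of_card_order_on Field_card_of)
  ultimately show "in_L_infinity omega_1 \<phi>"
    unfolding in_L_infinity_def using L by blast
qed (auto simp: in_L_infinity_def in_L_imp_countable_strings)

lemma trm_val_cong: "(\<And>v. v \<in> trm_vars t \<Longrightarrow> e v = e' v) \<Longrightarrow> trm_val A e t = trm_val A e' t"
  by (induction t) auto

lemma sat_cong:
  "(\<And>v. v \<in> free_vars \<phi> \<Longrightarrow> e v = e' v) \<Longrightarrow> sat A \<phi> e \<longleftrightarrow> sat A \<phi> e'"
proof (induction \<phi> arbitrary: e e')
  case (Eq s t)
  then show ?case using trm_val_cong[of s e e' A] trm_val_cong[of t e e' A] by auto
next
  case (Neg \<phi>)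
  then show ?case by (metis free_vars.simps(2) sat.simps(2))
next
  case (Conj I F)
  then have "sat A (F i) e \<longleftrightarrow> sat A (F i) e'" if "i \<in> I" for i
    using that by (metis UN_I free_vars.simps(3) rangeI)
  then show ?case by auto
next
  case (Disj I F)
  then have "sat A (F i) e \<longleftrightarrow> sat A (F i) e'" if "i \<in> I" for i
    using that by (metis UN_I free_vars.simps(4) rangeI)
  then show ?case by auto
next
  case (Exists Y \<phi>)
  have "sat A \<phi> (override_on e d Y) \<longleftrightarrow> sat A \<phi> (override_on e' d Y)" for d
    by (rule Exists.IH) (use Exists.prems in \<open>auto simp: override_on_def\<close>)
  then show ?case by auto
next
  case (Forall Y \<phi>)
  have "sat A \<phi> (override_on e d Y) \<longleftrightarrow> sat A \<phi> (override_on e' d Y)" for d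
    by (rule Forall.IH) (use Forall.prems in \<open>auto simp: override_on_def\<close>)
  then show ?case by auto
qed

lemma holds_sentence_iff:
  assumes "free_vars \<phi> = {}" "e \<in> UNIV \<rightarrow> carrier A"
  shows "holds A \<phi> \<longleftrightarrow> sat A \<phi> e"
  unfolding holds_def using assms sat_cong[of \<phi>] by (metis empty_iff)

primrec rename_trm :: "('v \<Rightarrow> 'w) \<Rightarrow> 'v trm \<Rightarrow> 'w trm" where
  "rename_trm f (Var v) = Var (f v)"
| "rename_trm f Zero = Zero"
| "rename_trm f (Plus s t) = Plus (rename_trm f s) (rename_trm f t)"

lemma trm_vars_rename: "trm_vars (rename_trm f t) = f ` trm_vars t"
  by (induction t) auto

lemma trm_val_rename: "trm_val A e (rename_trm f t) = trm_val A (e \<circ> f) t"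
  by (induction t) auto

text \<open>
  Over \<open>A\<close> and \<open>B\<close> the formula \<open>\<psi>\<close> defines the same relations as \<open>\<phi>\<close> does after each
  variable \<open>v\<close> of \<open>\<phi>\<close> is renamed to \<open>f v\<close>.
\<close>

definition transl ::
  "('a, 'm) monoid_scheme \<Rightarrow> ('b, 'n) monoid_scheme \<Rightarrow> 'v set \<Rightarrow> ('v \<Rightarrow> nat) \<Rightarrow>
    ('v, 'i) formula \<Rightarrow> (nat, 'j) formula \<Rightarrow> bool"
  where "transl A B V f \<phi> \<psi> \<longleftrightarrow> countable_strings \<psi> \<and> free_vars \<psi> \<subseteq> f ` V \<and>
    (\<forall>e. sat A \<psi> e \<longleftrightarrow> sat A \<phi> (e \<circ> f)) \<and> (\<forall>e. sat B \<psi> e \<longleftrightarrow> sat B \<phi> (e \<circ> f))"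

lemma transl_family:
  fixes A :: "('a, 'm) monoid_scheme" and B :: "('b, 'n) monoid_scheme"
    and F :: "'i \<Rightarrow> ('v, 'i) formula"
  assumes "\<And>i. i \<in> I \<Longrightarrow> \<exists>\<psi> :: (nat, ('a, 'b) joint_index) formula. transl A B V f (F i) \<psi>"
  obtains J and G :: "('a, 'b) joint_index \<Rightarrow> (nat, ('a, 'b) joint_index) formula"
  where "\<And>j. j \<in> J \<Longrightarrow> \<exists>i\<in>I. transl A B V f (F i) (G j)"
    and "\<And>i. i \<in> I \<Longrightarrow> \<exists>j\<in>J. transl A B V f (F i) (G j)"
proof -
  obtain H :: "'i \<Rightarrow> (nat, ('a, 'b) joint_index) formula"
    where H: "\<And>i. i \<in> I \<Longrightarrow> transl A B V f (F i) (H i)"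
    using assms by metis
  define idx where "idx i = ({e. sat A (F i) (e \<circ> f)}, {e. sat B (F i) (e \<circ> f)})" for i
  define G where "G j = H (inv_into I idx j)" for j
  have inv: "inv_into I idx (idx i) \<in> I" "idx (inv_into I idx (idx i)) = idx i" if "i \<in> I" for i
    using that by (auto intro: inv_into_into f_inv_into_f)
  have G: "transl A B V f (F i) (G (idx i))" if i: "i \<in> I" for i
  proof -
    let ?i = "inv_into I idx (idx i)"
    have "sat A (F ?i) (e \<circ> f) = sat A (F i) (e \<circ> f)" for e
      using inv(2)[OF i] by (auto simp: idx_def set_eq_iff)
    moreover have "sat B (F ?i) (e \<circ> f) = sat B (F i) (e \<circ> f)" for e
      using inv(2)[OF i] by (auto simp: idx_def set_eq_iff)
    ultimately show ?thesis
      using H[OF inv(1)[OF i]] by (simp add: transl_def G_def)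
  qed
  show thesis
    by (rule that[of "idx ` I" G]) (use G in \<open>blast+\<close>)
qed

lemma fresh_names:
  fixes f :: "'v \<Rightarrow> nat"
  assumes "countable Y" "infinite (- f ` V)"
  obtains f' :: "'v \<Rightarrow> nat"
  where "\<And>v. v \<notin> Y \<Longrightarrow> f' v = f v" "inj_on f' Y" "f' ` Y \<inter> f ` V = {}"
    "infinite (- f' ` (V \<union> Y))"
proof -
  define n where "n k = enumerate (- f ` V) k" for k :: nat
  have n: "n k \<notin> f ` V" "inj n" for k
    using assms(2) enumerate_in_set[of "- f ` V" k]
    by (auto simp: n_def[abs_def] strict_mono_enumerate strict_mono_imp_inj_on)
  define f' where "f' v = (if v \<in> Y then n (2 * to_nat_on Y v) else f v)" for v
  show thesis
  proof (rule that[of f'])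
    show "inj_on f' Y"
      using inj_on_to_nat_on[OF assms(1)] by (auto simp: inj_on_def f'_def dest!: injD[OF n(2)])
    have "range (\<lambda>k. n (2 * k + 1)) \<subseteq> - f' ` (V \<union> Y)"
    proof clarify
      fix k v
      assume "n (2 * k + 1) = f' v" "v \<in> V \<union> Y"
      then show False
        using n(1)[of "2 * k + 1"] injD[OF n(2), of "2 * k + 1" "2 * to_nat_on Y v"]
        by (auto simp: f'_def split: if_splits) presburger
    qed
    moreover have "infinite (range (\<lambda>k. n (2 * k + 1)))"
      by (rule range_inj_infinite) (auto intro!: injI dest!: injD[OF n(2)])
    ultimately show "infinite (- f' ` (V \<union> Y))"
      using finite_subset by blast
  qed (use n(1) in \<open>auto simp: f'_def\<close>)
qed

lemma override_transfer:
  assumes f': "\<And>v. v \<notin> Y \<Longrightarrow> f' v = f v" "inj_on f' Y" "f' ` Y \<inter> f ` V = {}"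
    and fv: "free_vars \<phi> \<subseteq> V \<union> Y"
    and sat: "\<And>e. sat A \<psi> e \<longleftrightarrow> sat A \<phi> (e \<circ> f')"
  shows "(\<exists>d \<in> f' ` Y \<rightarrow> C. sat A \<psi> (override_on e d (f' ` Y))) \<longleftrightarrow>
    (\<exists>d \<in> Y \<rightarrow> C. sat A \<phi> (override_on (e \<circ> f) d Y))" (is "?l \<longleftrightarrow> ?r")
proof -
  have *: "sat A \<psi> (override_on e d (f' ` Y)) \<longleftrightarrow> sat A \<phi> (override_on (e \<circ> f) (d \<circ> f') Y)" for d
    unfolding sat by (rule sat_cong) (use f' fv in \<open>auto simp: override_on_def\<close>)
  show ?thesis
  proof
    assume ?l
    then obtain d where "d \<in> f' ` Y \<rightarrow> C" "sat A \<psi> (override_on e d (f' ` Y))" by auto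
    then have "d \<circ> f' \<in> Y \<rightarrow> C" "sat A \<phi> (override_on (e \<circ> f) (d \<circ> f') Y)" using * by auto
    then show ?r by blast
  next
    assume ?r
    then obtain d where d: "d \<in> Y \<rightarrow> C" "sat A \<phi> (override_on (e \<circ> f) d Y)" by auto
    define d' where "d' = d \<circ> inv_into Y f'"
    have "override_on (e \<circ> f) (d' \<circ> f') Y = override_on (e \<circ> f) d Y"
      using f'(2) by (auto simp: override_on_def d'_def)
    moreover have "d' \<in> f' ` Y \<rightarrow> C"
      using d(1) f'(2) by (auto simp: d'_def)
    ultimately show ?l using * d(2) by (intro bexI[of _ d']) simp_all
  qed
qed

lemma transl_exists:
  fixes A :: "('a, 'm) monoid_scheme" and B :: "('b, 'n) monoid_scheme"
    and \<phi> :: "('v, 'i) formula"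
  assumes "countable_strings \<phi>" "free_vars \<phi> \<subseteq> V" "infinite (- f ` V)"
  shows "\<exists>\<psi> :: (nat, ('a, 'b) joint_index) formula. transl A B V f \<phi> \<psi>"
  using assms
proof (induction \<phi> arbitrary: V f)
  case (Eq s t)
  then show ?case
    by (intro exI[of _ "Eq (rename_trm f s) (rename_trm f t)"])
      (auto simp: transl_def trm_vars_rename trm_val_rename)
next
  case (Neg \<phi>)
  then obtain \<psi> :: "(nat, ('a, 'b) joint_index) formula" where "transl A B V f \<phi> \<psi>"
    by fastforce
  then show ?case
    by (intro exI[of _ "Neg \<psi>"]) (simp add: transl_def)
next
  case (Conj I F)
  then have "\<exists>\<psi> :: (nat, ('a, 'b) joint_index) formula. transl A B V f (F i) \<psi>" if "i \<in> I" for i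
    using that by (intro Conj.IH) auto
  then obtain J and G :: "('a, 'b) joint_index \<Rightarrow> (nat, ('a, 'b) joint_index) formula"
    where "\<And>j. j \<in> J \<Longrightarrow> \<exists>i\<in>I. transl A B V f (F i) (G j)"
      "\<And>i. i \<in> I \<Longrightarrow> \<exists>j\<in>J. transl A B V f (F i) (G j)"
    by (rule transl_family[of I A B V f F]) blast+
  then show ?case
    by (intro exI[of _ "Conj J G"]) (simp add: transl_def, blast)
next
  case (Disj I F)
  then have "\<exists>\<psi> :: (nat, ('a, 'b) joint_index) formula. transl A B V f (F i) \<psi>" if "i \<in> I" for i
    using that by (intro Disj.IH) auto
  then obtain J and G :: "('a, 'b) joint_index \<Rightarrow> (nat, ('a, 'b) joint_index) formula"
    where "\<And>j. j \<in> J \<Longrightarrow> \<exists>i\<in>I. transl A B V f (F i) (G j)"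
      "\<And>i. i \<in> I \<Longrightarrow> \<exists>j\<in>J. transl A B V f (F i) (G j)"
    by (rule transl_family[of I A B V f F]) blast+
  then show ?case
    by (intro exI[of _ "Disj J G"]) (simp add: transl_def, blast)
next
  case (Exists Y \<phi>)
  then obtain f' :: "'v \<Rightarrow> nat" where f': "\<And>v. v \<notin> Y \<Longrightarrow> f' v = f v" "inj_on f' Y"
    "f' ` Y \<inter> f ` V = {}" "infinite (- f' ` (V \<union> Y))"
    using fresh_names[of Y f V] by (metis countable_strings.simps(5))
  have fv: "free_vars \<phi> \<subseteq> V \<union> Y"
    using Exists.prems(2) by auto
  obtain \<psi> :: "(nat, ('a, 'b) joint_index) formula" where \<psi>: "transl A B (V \<union> Y) f' \<phi> \<psi>"
    using Exists.IH[OF _ fv f'(4)] Exists.prems(1) by auto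
  have "free_vars \<psi> - f' ` Y \<subseteq> f ` V"
    using \<psi> f'(1) by (force simp: transl_def)
  then show ?case
    using \<psi> Exists.prems(1) override_transfer[OF f'(1-3) fv, of A \<psi> "carrier A"]
      override_transfer[OF f'(1-3) fv, of B \<psi> "carrier B"]
    by (intro exI[of _ "Exists (f' ` Y) \<psi>"]) (simp add: transl_def)
next
  case (Forall Y \<phi>)
  then obtain f' :: "'v \<Rightarrow> nat" where f': "\<And>v. v \<notin> Y \<Longrightarrow> f' v = f v" "inj_on f' Y"
    "f' ` Y \<inter> f ` V = {}" "infinite (- f' ` (V \<union> Y))"
    using fresh_names[of Y f V] by (metis countable_strings.simps(6))
  have fv: "free_vars (Neg \<phi>) \<subseteq> V \<union> Y"
    using Forall.prems(2) by auto
  obtain \<psi> :: "(nat, ('a, 'b) joint_index) formula" where \<psi>: "transl A B (V \<union> Y) f' \<phi> \<psi>"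
    using Forall.IH[OF _ _ f'(4)] fv Forall.prems(1) by auto
  have "free_vars \<psi> - f' ` Y \<subseteq> f ` V"
    using \<psi> f'(1) by (force simp: transl_def)
  moreover have "sat A (Forall (f' ` Y) \<psi>) e \<longleftrightarrow> sat A (Forall Y \<phi>) (e \<circ> f)" for e
  proof -
    have "(\<exists>d \<in> f' ` Y \<rightarrow> carrier A. sat A (Neg \<psi>) (override_on e d (f' ` Y))) \<longleftrightarrow>
      (\<exists>d \<in> Y \<rightarrow> carrier A. sat A (Neg \<phi>) (override_on (e \<circ> f) d Y))"
      by (rule override_transfer[OF f'(1-3) fv]) (use \<psi> in \<open>auto simp: transl_def\<close>)
    then show ?thesis
      unfolding sat.simps by blast
  qed
  moreover have "sat B (Forall (f' ` Y) \<psi>) e \<longleftrightarrow> sat B (Forall Y \<phi>) (e \<circ> f)" for e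
  proof -
    have "(\<exists>d \<in> f' ` Y \<rightarrow> carrier B. sat B (Neg \<psi>) (override_on e d (f' ` Y))) \<longleftrightarrow>
      (\<exists>d \<in> Y \<rightarrow> carrier B. sat B (Neg \<phi>) (override_on (e \<circ> f) d Y))"
      by (rule override_transfer[OF f'(1-3) fv]) (use \<psi> in \<open>auto simp: transl_def\<close>)
    then show ?thesis
      unfolding sat.simps by blast
  qed
  ultimately have "transl A B V f (Forall Y \<phi>) (Forall (f' ` Y) \<psi>)"
    using \<psi> Forall.prems(1) by (simp add: transl_def del: sat.simps)
  then show ?case by blast
qed

theorem equiv_L_infinity_omega_1_all_types:
  fixes A :: "('a, 'm) monoid_scheme" and B :: "('b, 'n) monoid_scheme"
    and \<phi> :: "('v, 'i) formula"
  assumes "monoid A" "monoid B" "equiv_L_infinity_omega_1 A B"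
    and "in_L_infinity omega_1 \<phi>" "free_vars \<phi> = {}"
  shows "holds A \<phi> \<longleftrightarrow> holds B \<phi>"
proof -
  have \<phi>: "countable_strings \<phi>" "free_vars \<phi> \<subseteq> {}" "infinite (- (\<lambda>_. 0 :: nat) ` ({} :: 'v set))"
    using assms(4,5) by (auto simp: in_L_infinity_omega_1_iff)
  obtain \<psi> :: "(nat, ('a, 'b) joint_index) formula" where \<psi>: "transl A B {} (\<lambda>_. 0) \<phi> \<psi>"
    using transl_exists[OF \<phi>] by blast
  then have fv: "free_vars \<psi> = {}" and "in_L_infinity omega_1 \<psi>"
    by (auto simp: transl_def in_L_infinity_omega_1_iff)
  then have "holds A \<psi> \<longleftrightarrow> holds B \<psi>"
    using assms(3) by (auto simp: equiv_L_infinity_omega_1_def)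
  moreover have "(\<lambda>_. \<one>\<^bsub>A\<^esub>) \<in> UNIV \<rightarrow> carrier A" "(\<lambda>_. \<one>\<^bsub>B\<^esub>) \<in> UNIV \<rightarrow> carrier B"
    using assms(1,2) by (auto intro: monoid.one_closed)
  then have "holds A \<psi> \<longleftrightarrow> sat A \<psi> (\<lambda>_. \<one>\<^bsub>A\<^esub>)" "holds A \<phi> \<longleftrightarrow> sat A \<phi> (\<lambda>_. \<one>\<^bsub>A\<^esub>)"
    "holds B \<psi> \<longleftrightarrow> sat B \<psi> (\<lambda>_. \<one>\<^bsub>B\<^esub>)" "holds B \<phi> \<longleftrightarrow> sat B \<phi> (\<lambda>_. \<one>\<^bsub>B\<^esub>)"
    using fv assms(5) by (auto intro!: holds_sentence_iff)
  moreover have "sat A \<psi> (\<lambda>_. \<one>\<^bsub>A\<^esub>) \<longleftrightarrow> sat A \<phi> (\<lambda>_. \<one>\<^bsub>A\<^esub>)"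
    "sat B \<psi> (\<lambda>_. \<one>\<^bsub>B\<^esub>) \<longleftrightarrow> sat B \<phi> (\<lambda>_. \<one>\<^bsub>B\<^esub>)"
    using \<psi> by (simp_all add: transl_def comp_def)
  ultimately show ?thesis by simp
qed

end

theory Submission
  imports Defs
begin

text \<open>
  Fix a sequence \<open>a\<close> in an abelian group and, for \<open>x \<in> \<int>\<^sup>\<omega>\<close>, consider the infinite system of equations
  \<open>z\<^sub>n = x\<^sub>n a\<^sub>n + 2 z\<^sub>n\<^sub>+\<^sub>1\<close>. A solution makes \<open>z\<^sub>0\<close> a value for the formal series \<open>\<Sum> 2\<^sup>n x\<^sub>n a\<^sub>n\<close>, with
  the \<open>z\<^sub>n\<close> as its rescaled tails. If the group has no nonzero sequence
  \<open>d\<^sub>n = 2 d\<^sub>n\<^sub>+\<^sub>1\<close>, the value \<open>z\<^sub>0\<close> is unique; if moreover every \<open>x\<close> admits a solution, then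
  \<open>x \<mapsto> z\<^sub>0\<close> is a homomorphism on \<open>\<int>\<^sup>\<omega>\<close> which sends the \<open>n\<close>-th unit vector to \<open>2\<^sup>n a\<^sub>n\<close>. In a
  torsion-free group with all \<open>a\<^sub>n\<close> nonzero, this homomorphism contradicts slenderness
  (\<open>not_slender_if_series_converge\<close>).

  Both conditions, the solvability for all \<open>x\<close> over some nonzero sequence \<open>a\<close> and the absence of nonzero
  sequences \<open>d\<close>, are sentences with countable quantifier strings: the only large operation is the
  conjunction over all \<open>x \<in> \<int>\<^sup>\<omega>\<close>. They hold in \<open>\<int>\<^sup>\<omega>\<close> itself with \<open>a\<^sub>n\<close> the unit vectors, hence in
  every group that is equivalent to it.
\<close>

section \<open>Dyadic series in abelian groups\<close>

text \<open>
  The sequence \<open>z\<close> consists of the tails \<open>z\<^sub>n = \<Sum>\<^sub>k 2\<^sup>k x\<^sub>n\<^sub>+\<^sub>k a\<^sub>n\<^sub>+\<^sub>k\<close> of a dyadic series. The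
  recursion expresses this without a topology.
\<close>

definition dyadic_tails ::
  "('a, 'm) monoid_scheme \<Rightarrow> (nat \<Rightarrow> 'a) \<Rightarrow> (nat \<Rightarrow> int) \<Rightarrow> (nat \<Rightarrow> 'a) \<Rightarrow> bool"
  where "dyadic_tails G a x z \<longleftrightarrow> (\<forall>n. z n \<in> carrier G \<and>
    z n = a n [^]\<^bsub>G\<^esub> x n \<otimes>\<^bsub>G\<^esub> (z (Suc n) \<otimes>\<^bsub>G\<^esub> z (Suc n)))"

text \<open>
  In a torsion-free group halves are unique, so the elements \<open>d 0\<close> are exactly those divisible by
  every power of 2. Slenderness alone does not exclude nonzero ones (the dyadic rationals are
  slender), so this property has to be transferred from \<open>\<int>\<^sup>\<omega>\<close>.
\<close>

definition no_2_divisible_chain :: "('a, 'm) monoid_scheme \<Rightarrow> bool"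
  where "no_2_divisible_chain G \<longleftrightarrow>
    (\<forall>d. (\<forall>n. d n \<in> carrier G \<and> d n = d (Suc n) \<otimes>\<^bsub>G\<^esub> d (Suc n)) \<longrightarrow> d 0 = \<one>\<^bsub>G\<^esub>)"

lemma (in comm_group) dyadic_tails_mult:
  assumes "\<And>n. a n \<in> carrier G" "dyadic_tails G a x z" "dyadic_tails G a y w"
  shows "dyadic_tails G a (\<lambda>n. x n + y n) (\<lambda>n. z n \<otimes> w n)"
proof -
  have z: "z n \<in> carrier G" "z n = a n [^] x n \<otimes> (z (Suc n) \<otimes> z (Suc n))" for n
    using assms(2) unfolding dyadic_tails_def by blast+
  have w: "w n \<in> carrier G" "w n = a n [^] y n \<otimes> (w (Suc n) \<otimes> w (Suc n))" for n
    using assms(3) unfolding dyadic_tails_def by blast+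
  show ?thesis
    unfolding dyadic_tails_def
  proof (intro allI conjI)
    fix n
    show "z n \<otimes> w n \<in> carrier G" using z(1) w(1) by simp
    have "z n \<otimes> w n =
      (a n [^] x n \<otimes> (z (Suc n) \<otimes> z (Suc n))) \<otimes> (a n [^] y n \<otimes> (w (Suc n) \<otimes> w (Suc n)))"
      by (rule arg_cong2[where f = "(\<otimes>)", OF z(2) w(2)])
    also have "\<dots> = (a n [^] x n \<otimes> a n [^] y n) \<otimes>
        ((z (Suc n) \<otimes> w (Suc n)) \<otimes> (z (Suc n) \<otimes> w (Suc n)))"
      using z(1) w(1) assms(1) by (simp add: m_ac)
    finally show "z n \<otimes> w n =
        a n [^] (x n + y n) \<otimes> ((z (Suc n) \<otimes> w (Suc n)) \<otimes> (z (Suc n) \<otimes> w (Suc n)))"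
      using assms(1) by (simp add: int_pow_mult)
  qed
qed

lemma (in comm_group) dyadic_tails_inv:
  assumes "\<And>n. a n \<in> carrier G" "dyadic_tails G a x z"
  shows "dyadic_tails G a (\<lambda>n. - x n) (\<lambda>n. inv (z n))"
proof -
  have z: "z n \<in> carrier G" "z n = a n [^] x n \<otimes> (z (Suc n) \<otimes> z (Suc n))" for n
    using assms(2) unfolding dyadic_tails_def by blast+
  show ?thesis
    unfolding dyadic_tails_def
  proof (intro allI conjI)
    fix n
    show "inv (z n) \<in> carrier G" using z(1) by simp
    have "inv (z n) = inv (a n [^] x n \<otimes> (z (Suc n) \<otimes> z (Suc n)))"
      by (rule arg_cong[where f = "m_inv G", OF z(2)])
    then show "inv (z n) = a n [^] (- x n) \<otimes> (inv (z (Suc n)) \<otimes> inv (z (Suc n)))"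
      using z(1) assms(1) by (simp add: inv_mult int_pow_neg)
  qed
qed

text \<open>The difference of two solutions solves the homogeneous system, which is a 2-divisible chain.\<close>

lemma (in comm_group) dyadic_value_unique:
  assumes a: "\<And>n. a n \<in> carrier G" and "no_2_divisible_chain G"
    and z: "dyadic_tails G a x z" and w: "dyadic_tails G a x w"
  shows "z 0 = w 0"
proof -
  have c: "z 0 \<in> carrier G" "w n \<in> carrier G" for n
    using z w unfolding dyadic_tails_def by blast+
  have *: "dyadic_tails G a (\<lambda>n. x n + - x n) (\<lambda>n. z n \<otimes> inv (w n))"
    using dyadic_tails_mult[OF a z dyadic_tails_inv[OF a w]] .
  then have carrier: "z n \<otimes> inv (w n) \<in> carrier G" for n
    unfolding dyadic_tails_def by blast
  have "z n \<otimes> inv (w n) = (z (Suc n) \<otimes> inv (w (Suc n))) \<otimes> (z (Suc n) \<otimes> inv (w (Suc n)))" for n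
  proof -
    have "z n \<otimes> inv (w n) = a n [^] (x n + - x n) \<otimes>
        ((z (Suc n) \<otimes> inv (w (Suc n))) \<otimes> (z (Suc n) \<otimes> inv (w (Suc n))))"
      using * unfolding dyadic_tails_def by blast
    also have "a n [^] (x n + - x n) = \<one>"
      by simp
    finally show ?thesis
      using carrier by (metis l_one m_closed)
  qed
  note d = carrier this
  have "z 0 \<otimes> inv (w 0) = \<one>"
    using assms(2)[unfolded no_2_divisible_chain_def, rule_format, of "\<lambda>n. z n \<otimes> inv (w n)"] d
    by blast
  then show ?thesis
    using c by (metis inv_closed inv_inv inv_equality)
qed

text \<open>
  The series of the \<open>m\<close>-th unit vector is finite, with the value \<open>2\<^sup>m a\<^sub>m\<close> at \<open>n = 0\<close>; its tails
  beyond \<open>m\<close> vanish.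
\<close>

lemma (in comm_group) dyadic_tails_unit_vector:
  assumes a: "\<And>n. a n \<in> carrier G"
  shows "dyadic_tails G a (unit_vector m)
    (\<lambda>n. if n \<le> m then a m [^] ((2::nat) ^ (m - n)) else \<one>)"
  unfolding dyadic_tails_def
proof (intro allI conjI)
  fix n
  let ?z = "\<lambda>n. if n \<le> m then a m [^] ((2::nat) ^ (m - n)) else \<one>"
  show "?z n \<in> carrier G" using a by simp
  consider "n < m" | "n = m" | "n > m" by linarith
  then show "?z n = a n [^] unit_vector m n \<otimes> (?z (Suc n) \<otimes> ?z (Suc n))"
  proof cases
    case 1
    then have "m - n = Suc (m - Suc n)" by simp
    then have "(2::nat) ^ (m - n) = 2 ^ (m - Suc n) + 2 ^ (m - Suc n)" by simp
    then show ?thesis using 1 a by (simp add: unit_vector_def nat_pow_mult)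
  qed (use a in \<open>auto simp: unit_vector_def int_pow_1\<close>)
qed


section \<open>Dyadic series in the Baer-Specker group\<close>

lemma carrier_baer_specker [simp]: "carrier baer_specker = UNIV"
  by (auto simp: baer_specker_def product_group_def integer_group_def)

lemma mult_baer_specker [simp]: "x \<otimes>\<^bsub>baer_specker\<^esub> y = (\<lambda>i. x i + y i)"
  by (auto simp: baer_specker_def product_group_def integer_group_def)

lemma one_baer_specker [simp]: "\<one>\<^bsub>baer_specker\<^esub> = (\<lambda>_. 0)"
  by (auto simp: baer_specker_def product_group_def integer_group_def)

lemma comm_group_baer_specker: "comm_group baer_specker"
proof (rule comm_groupI)
  fix x :: "nat \<Rightarrow> int"
  show "\<exists>y\<in>carrier baer_specker. y \<otimes>\<^bsub>baer_specker\<^esub> x = \<one>\<^bsub>baer_specker\<^esub>"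
    by (rule bexI[of _ "\<lambda>i. - x i"]) simp_all
qed (simp_all add: algebra_simps)

lemma int_pow_baer_specker [simp]: "x [^]\<^bsub>baer_specker\<^esub> (k :: int) = (\<lambda>i. k * x i)"
proof -
  interpret comm_group baer_specker by (rule comm_group_baer_specker)
  have nat: "x [^]\<^bsub>baer_specker\<^esub> n = (\<lambda>i. int n * x i)" for n :: nat
    by (induction n) (auto simp: algebra_simps)
  have inv: "inv\<^bsub>baer_specker\<^esub> y = (\<lambda>i. - y i)" for y
    by (rule inv_equality) auto
  show ?thesis
    by (auto simp: int_pow_def2 nat inv)
qed

text \<open>
  Over the unit vectors every series converges: it is computed coordinatewise, where each
  coordinate receives only one summand.
\<close>

lemma dyadic_tails_baer_specker:
  "dyadic_tails baer_specker unit_vector x (\<lambda>n i. if n \<le> i then 2 ^ (i - n) * x i else 0)"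
  unfolding dyadic_tails_def
proof (intro allI conjI)
  fix n
  have *: "(2::int) ^ (i - n) = 2 * 2 ^ (i - Suc n)" if "n < i" for i
    using that by (metis Suc_diff_Suc power_Suc)
  show "(\<lambda>i. if n \<le> i then 2 ^ (i - n) * x i else 0) =
      unit_vector n [^]\<^bsub>baer_specker\<^esub> x n \<otimes>\<^bsub>baer_specker\<^esub>
      ((\<lambda>i. if Suc n \<le> i then 2 ^ (i - Suc n) * x i else 0) \<otimes>\<^bsub>baer_specker\<^esub>
       (\<lambda>i. if Suc n \<le> i then 2 ^ (i - Suc n) * x i else 0))"
  proof
    fix i
    \<comment> \<open>At \<open>i = n\<close> the unit vector contributes \<open>x n\<close>; beyond \<open>n\<close> only the doubled next tail does.\<close>
    consider "i < n" | "i = n" | "n < i" by linarith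
    then show "(if n \<le> i then 2 ^ (i - n) * x i else 0) =
      (unit_vector n [^]\<^bsub>baer_specker\<^esub> x n \<otimes>\<^bsub>baer_specker\<^esub>
      ((\<lambda>i. if Suc n \<le> i then 2 ^ (i - Suc n) * x i else 0) \<otimes>\<^bsub>baer_specker\<^esub>
       (\<lambda>i. if Suc n \<le> i then 2 ^ (i - Suc n) * x i else 0))) i"
      by cases (simp_all add: unit_vector_def *)
  qed
qed simp

text \<open>Every coordinate of \<open>d 0\<close> is divisible by all powers of 2, hence zero.\<close>

lemma no_2_divisible_chain_baer_specker: "no_2_divisible_chain baer_specker"
  unfolding no_2_divisible_chain_def
proof (intro allI impI)
  fix d assume "\<forall>n. d n \<in> carrier baer_specker \<and> d n = d (Suc n) \<otimes>\<^bsub>baer_specker\<^esub> d (Suc n)"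
  then have double: "d n = d (Suc n) \<otimes>\<^bsub>baer_specker\<^esub> d (Suc n)" for n
    by blast
  have step: "d n i = 2 * d (Suc n) i" for n i
    by (subst double) simp
  have pow: "d 0 i = 2 ^ n * d n i" for n i
  proof (induction n)
    case (Suc n)
    have "2 ^ n * d n i = 2 ^ Suc n * d (Suc n) i"
      by (subst step) simp
    with Suc show ?case by metis
  qed simp
  have "d 0 i = 0" for i
  proof (rule ccontr)
    assume ne: "d 0 i \<noteq> 0"
    \<comment> \<open>The exponent \<open>\<bar>d 0 i\<bar>\<close> makes the power exceed \<open>\<bar>d 0 i\<bar>\<close> itself.\<close>
    have "2 ^ nat \<bar>d 0 i\<bar> dvd d 0 i"
      by (rule dvdI, rule pow)
    then have "(2::int) ^ nat \<bar>d 0 i\<bar> \<le> \<bar>d 0 i\<bar>"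
      using dvd_imp_le_int[OF ne] by (metis abs_numeral power_abs)
    moreover have "int (nat \<bar>d 0 i\<bar>) < 2 ^ nat \<bar>d 0 i\<bar>"
      by (metis less_exp of_nat_less_iff of_nat_numeral of_nat_power)
    ultimately show False by simp
  qed
  then show "d 0 = \<one>\<^bsub>baer_specker\<^esub>" by auto
qed


section \<open>Convergence of dyadic series refutes slenderness\<close>

text \<open>
  The homomorphism sends \<open>x\<close> to the value of \<open>\<Sum> 2\<^sup>n x\<^sub>n a\<^sub>n\<close>. Uniqueness of values makes it
  additive and determines it on unit vectors, where torsion-freeness keeps \<open>2\<^sup>m a\<^sub>m\<close> nonzero.
\<close>

lemma not_slender_if_series_converge:
  fixes G (structure)
  assumes a: "\<And>n. a n \<in> carrier G" "\<And>n. a n \<noteq> \<one>"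
    and series: "\<And>x. \<exists>z. dyadic_tails G a x z"
    and no_chain: "no_2_divisible_chain G"
  shows "\<not> slender G"
proof
  assume slender: "slender G"
  then interpret comm_group G by (simp add: slender_def)
  define h where "h x = (SOME z. dyadic_tails G a x z) 0" for x
  have h: "h x = z 0" if "dyadic_tails G a x z" for x z
    unfolding h_def
    by (rule dyadic_value_unique[where a = a and x = x and w = z, OF a(1) no_chain])
      (rule someI[of "dyadic_tails G a x", OF that], rule that)
  have "h \<in> hom baer_specker G"
  proof (rule homI)
    fix x y
    obtain z w where zw: "dyadic_tails G a x z" "dyadic_tails G a y w"
      using series by blast
    then show "h x \<in> carrier G" using h unfolding dyadic_tails_def by metis
    show "h (x \<otimes>\<^bsub>baer_specker\<^esub> y) = h x \<otimes> h y"
      using h[OF zw(1)] h[OF zw(2)] h[OF dyadic_tails_mult[where a = a, OF a(1) zw]] by simp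
  qed
  moreover have "h (unit_vector m) \<noteq> \<one>" for m
  proof -
    have "h (unit_vector m) = a m [^] ((2::nat) ^ m)"
      using h[OF dyadic_tails_unit_vector[where a = a, OF a(1)]] by simp
    moreover have "(2::nat) ^ m > 0" by simp
    ultimately show ?thesis
      using slender a[of m] unfolding slender_def torsion_free_group_def by metis
  qed
  ultimately show False
    using slender by (auto simp: slender_def)
qed


section \<open>Infinitary sentences for convergence and uniqueness\<close>

text \<open>
  Variables \<open>Inl n\<close> stand for \<open>a\<^sub>n\<close> and \<open>Inr n\<close> for \<open>z\<^sub>n\<close> or \<open>d\<^sub>n\<close>. Indices \<open>Inl n\<close> serve the countable
  conjunctions and \<open>Inr x\<close> the conjunction over \<open>x \<in> \<int>\<^sup>\<omega>\<close>.
\<close>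

type_synonym series_formula = "(nat + nat, nat + (nat \<Rightarrow> int)) formula"

primrec multiple :: "nat \<Rightarrow> 'v trm \<Rightarrow> 'v trm" where
  "multiple 0 t = Zero"
| "multiple (Suc k) t = Plus (multiple k t) t"

lemma trm_val_multiple [simp]: "trm_val A e (multiple k t) = trm_val A e t [^]\<^bsub>A\<^esub> k"
  by (induction k) auto

lemma trm_vars_multiple: "trm_vars (multiple k t) \<subseteq> trm_vars t"
  by (induction k) auto

text \<open>
  Terms have no negation, so the negative part of the coefficient \<open>x\<^sub>n\<close> is moved to the left of the
  equation.
\<close>

definition tail_equation :: "(nat \<Rightarrow> int) \<Rightarrow> nat \<Rightarrow> series_formula"
  where "tail_equation x n =
    Eq (Plus (Var (Inr n)) (multiple (nat (- x n)) (Var (Inl n))))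
       (Plus (multiple (nat (x n)) (Var (Inl n))) (Plus (Var (Inr (Suc n))) (Var (Inr (Suc n)))))"

definition series_conjunct :: "nat + (nat \<Rightarrow> int) \<Rightarrow> series_formula"
  where "series_conjunct j = (case j of
      Inl n \<Rightarrow> Neg (Eq (Var (Inl n)) Zero)
    | Inr x \<Rightarrow> Exists (range Inr) (Conj (range Inl) (\<lambda>i. tail_equation x (projl i))))"

definition series_sentence :: series_formula
  where "series_sentence = Exists (range Inl) (Conj UNIV series_conjunct)"

text \<open>Together, the conjuncts describe a 2-divisible chain that starts at a nonzero element.\<close>

definition chain_conjunct :: "nat \<Rightarrow> series_formula"
  where "chain_conjunct k = (case k of
      0 \<Rightarrow> Neg (Eq (Var (Inr 0)) Zero)
    | Suc n \<Rightarrow> Eq (Var (Inr n)) (Plus (Var (Inr (Suc n))) (Var (Inr (Suc n)))))"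

definition no_chain_sentence :: series_formula
  where "no_chain_sentence =
    Neg (Exists (range Inr) (Conj (range Inl) (\<lambda>i. chain_conjunct (projl i))))"

lemma in_L_series_sentence: "in_L_infinity omega_1 series_sentence"
  by (auto simp: in_L_infinity_omega_1_iff series_sentence_def series_conjunct_def
      tail_equation_def split: sum.split)

lemma free_vars_series_sentence: "free_vars series_sentence = {}"
proof -
  have "free_vars (tail_equation x n) \<subseteq> {Inl n, Inr n, Inr (Suc n)}" for x n
    using trm_vars_multiple[of _ "Var (Inl n)"] by (auto simp: tail_equation_def)
  then have "free_vars (series_conjunct j) \<subseteq> range Inl" for j
    by (cases j) (fastforce simp: series_conjunct_def)+
  then show ?thesis
    by (auto simp: series_sentence_def)
qed

lemma in_L_no_chain_sentence: "in_L_infinity omega_1 no_chain_sentence"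
  by (auto simp: in_L_infinity_omega_1_iff no_chain_sentence_def chain_conjunct_def
      split: nat.split)

lemma free_vars_no_chain_sentence: "free_vars no_chain_sentence = {}"
proof -
  have "free_vars (chain_conjunct k) \<subseteq> range Inr" for k
    by (cases k) (auto simp: chain_conjunct_def)
  then show ?thesis
    by (auto simp: no_chain_sentence_def)
qed

text \<open>
  A quantifier over the block of variables \<open>range c\<close> is a quantifier over sequences of elements.
\<close>

lemma Pi_range_iff: "inj c \<Longrightarrow> (\<exists>d\<in>range c \<rightarrow> C. P (d \<circ> c)) \<longleftrightarrow> (\<exists>f\<in>UNIV \<rightarrow> C. P f)"
proof (intro iffI; elim bexE)
  fix d assume "d \<in> range c \<rightarrow> C" "P (d \<circ> c)"
  then show "\<exists>f\<in>UNIV \<rightarrow> C. P f"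
    by (intro bexI[of _ "d \<circ> c"]) auto
next
  fix f assume "inj c" "f \<in> UNIV \<rightarrow> C" "P f"
  then show "\<exists>d\<in>range c \<rightarrow> C. P (d \<circ> c)"
    by (intro bexI[of _ "f \<circ> inv_into UNIV c"]) (auto simp: comp_def)
qed

text \<open>At most one of the two natural exponents is nonzero, so moving it across recovers \<open>a [^] k\<close>.\<close>

lemma (in comm_group) mult_pow_cancel_iff:
  assumes a: "a \<in> carrier G" and u: "u \<in> carrier G" and v: "v \<in> carrier G"
  shows "u \<otimes> a [^] nat (- k) = a [^] nat k \<otimes> v \<longleftrightarrow> u = a [^] k \<otimes> v"
proof (cases "k \<ge> 0")
  case True
  then have "a [^] nat k = a [^] k" "nat (- k) = 0"
    by simp_all
  then show ?thesis
    using u by (simp only: nat_pow_0 r_one)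
next
  case False
  then have neg: "a [^] k = inv (a [^] nat (- k))" "nat k = 0"
    by (simp_all only: int_pow_def2 not_le if_True nat_le_0 less_imp_le)
  have "u = inv (a [^] nat (- k)) \<otimes> v \<longleftrightarrow> v = a [^] nat (- k) \<otimes> u"
    by (rule inv_solve_left) (use assms in auto)
  also have "a [^] nat (- k) \<otimes> u = u \<otimes> a [^] nat (- k)"
    by (rule m_comm) (use assms in auto)
  finally show ?thesis
    unfolding neg nat_pow_0 l_one[OF v] by metis
qed

lemma (in comm_group) sat_tail_equation:
  assumes "e (Inl n) \<in> carrier G" "e (Inr n) \<in> carrier G" "e (Inr (Suc n)) \<in> carrier G"
  shows "sat G (tail_equation x n) e \<longleftrightarrow>
    e (Inr n) = e (Inl n) [^] x n \<otimes> (e (Inr (Suc n)) \<otimes> e (Inr (Suc n)))"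
  unfolding tail_equation_def sat.simps trm_val.simps trm_val_multiple
  by (rule mult_pow_cancel_iff) (use assms in auto)

lemma (in comm_group) holds_series_sentence_iff:
  "holds G series_sentence \<longleftrightarrow>
    (\<exists>a\<in>UNIV \<rightarrow> carrier G. (\<forall>n. a n \<noteq> \<one>) \<and> (\<forall>x. \<exists>z. dyadic_tails G a x z))"
proof -
  let ?e = "\<lambda>_. \<one> :: 'a"
  have tails: "sat G (series_conjunct (Inr x)) (override_on ?e c (range Inl)) \<longleftrightarrow>
      (\<exists>z. dyadic_tails G (c \<circ> Inl) x z)" if c: "c \<in> range Inl \<rightarrow> carrier G" for c :: "nat + nat \<Rightarrow> 'a" and x
  proof -
    have "sat G (tail_equation x n) (override_on (override_on ?e c (range Inl)) d (range Inr)) \<longleftrightarrow>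
        (d \<circ> Inr) n = (c \<circ> Inl) n [^] x n \<otimes> ((d \<circ> Inr) (Suc n) \<otimes> (d \<circ> Inr) (Suc n))"
      if "d \<in> range Inr \<rightarrow> carrier G" for d n
      by (subst sat_tail_equation) (use c that in \<open>auto simp: override_on_def Pi_def\<close>)
    then have "sat G (series_conjunct (Inr x)) (override_on ?e c (range Inl)) \<longleftrightarrow>
        (\<exists>d\<in>range (Inr :: nat \<Rightarrow> nat + nat) \<rightarrow> carrier G. \<forall>n.
          (d \<circ> Inr) n = (c \<circ> Inl) n [^] x n \<otimes> ((d \<circ> Inr) (Suc n) \<otimes> (d \<circ> Inr) (Suc n)))"
      by (simp add: series_conjunct_def cong: bex_cong)
    also have "\<dots> \<longleftrightarrow> (\<exists>z\<in>UNIV \<rightarrow> carrier G. \<forall>n.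
        z n = (c \<circ> Inl) n [^] x n \<otimes> (z (Suc n) \<otimes> z (Suc n)))"
      using Pi_range_iff[where c = "Inr :: nat \<Rightarrow> nat + nat" and C = "carrier G" and
          P = "\<lambda>z. \<forall>n. z n = (c \<circ> Inl) n [^] x n \<otimes> (z (Suc n) \<otimes> z (Suc n))"]
      by (simp only: inj_Inr True_implies_equals)
    finally show ?thesis
      by (auto simp: dyadic_tails_def Pi_def)
  qed
  have "holds G series_sentence \<longleftrightarrow> sat G series_sentence ?e"
    using free_vars_series_sentence by (intro holds_sentence_iff) auto
  also have "\<dots> \<longleftrightarrow> (\<exists>c\<in>range (Inl :: nat \<Rightarrow> nat + nat) \<rightarrow> carrier G.
      (\<forall>n. (c \<circ> Inl) n \<noteq> \<one>) \<and> (\<forall>x. \<exists>z. dyadic_tails G (c \<circ> Inl) x z))"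
    unfolding series_sentence_def sat.simps
  proof (rule bex_cong[OF refl])
    fix c :: "nat + nat \<Rightarrow> 'a" assume c: "c \<in> range Inl \<rightarrow> carrier G"
    have "(\<forall>j\<in>UNIV. sat G (series_conjunct j) (override_on ?e c (range Inl))) \<longleftrightarrow>
      (\<forall>n. sat G (series_conjunct (Inl n)) (override_on ?e c (range Inl))) \<and>
      (\<forall>x. sat G (series_conjunct (Inr x)) (override_on ?e c (range Inl)))"
      by (metis UNIV_I sumE)
    then show "(\<forall>j\<in>UNIV. sat G (series_conjunct j) (override_on ?e c (range Inl))) \<longleftrightarrow>
      (\<forall>n. (c \<circ> Inl) n \<noteq> \<one>) \<and> (\<forall>x. \<exists>z. dyadic_tails G (c \<circ> Inl) x z)"
      using tails[OF c] by (simp add: series_conjunct_def)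
  qed
  also have "\<dots> \<longleftrightarrow>
      (\<exists>a\<in>UNIV \<rightarrow> carrier G. (\<forall>n. a n \<noteq> \<one>) \<and> (\<forall>x. \<exists>z. dyadic_tails G a x z))"
    using Pi_range_iff[where c = "Inl :: nat \<Rightarrow> nat + nat" and C = "carrier G" and
        P = "\<lambda>a. (\<forall>n. a n \<noteq> \<one>) \<and> (\<forall>x. \<exists>z. dyadic_tails G a x z)"]
    by (simp only: inj_Inl True_implies_equals)
  finally show ?thesis .
qed

lemma (in comm_group) holds_no_chain_sentence_iff:
  "holds G no_chain_sentence \<longleftrightarrow> no_2_divisible_chain G"
proof -
  let ?e = "\<lambda>_. \<one> :: 'a"
  have conjuncts: "(\<forall>n. sat G (chain_conjunct n) e) \<longleftrightarrow>
      e (Inr 0) \<noteq> \<one> \<and> (\<forall>n. e (Inr n) = e (Inr (Suc n)) \<otimes> e (Inr (Suc n)))" for e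
  proof -
    have "(\<forall>n. sat G (chain_conjunct n) e) \<longleftrightarrow>
        sat G (chain_conjunct 0) e \<and> (\<forall>n. sat G (chain_conjunct (Suc n)) e)"
      by (metis not0_implies_Suc)
    then show ?thesis by (simp add: chain_conjunct_def)
  qed
  have "holds G no_chain_sentence \<longleftrightarrow> sat G no_chain_sentence ?e"
    using free_vars_no_chain_sentence by (intro holds_sentence_iff) auto
  also have "\<dots> \<longleftrightarrow> \<not> (\<exists>d\<in>range (Inr :: nat \<Rightarrow> nat + nat) \<rightarrow> carrier G.
      (d \<circ> Inr) 0 \<noteq> \<one> \<and> (\<forall>n. (d \<circ> Inr) n = (d \<circ> Inr) (Suc n) \<otimes> (d \<circ> Inr) (Suc n)))"
    by (simp add: no_chain_sentence_def conjuncts)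
  also have "\<dots> \<longleftrightarrow> \<not> (\<exists>d\<in>UNIV \<rightarrow> carrier G.
      d 0 \<noteq> \<one> \<and> (\<forall>n. d n = d (Suc n) \<otimes> d (Suc n)))"
    using Pi_range_iff[where c = "Inr :: nat \<Rightarrow> nat + nat" and C = "carrier G" and
        P = "\<lambda>d. d 0 \<noteq> \<one> \<and> (\<forall>n. d n = d (Suc n) \<otimes> d (Suc n))"]
    by (simp only: inj_Inr True_implies_equals)
  finally show ?thesis
    unfolding no_2_divisible_chain_def Pi_iff Bex_def by blast
qed

theorem corollary0p2:
  shows "\<not> (\<exists>G :: 'g monoid. slender G \<and> equiv_L_infinity_omega_1 baer_specker G)"
proof
  assume "\<exists>G :: 'g monoid. slender G \<and> equiv_L_infinity_omega_1 baer_specker G"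
  then obtain G :: "'g monoid"
    where slender: "slender G" and equiv: "equiv_L_infinity_omega_1 baer_specker G"
    by blast
  interpret G: comm_group G
    using slender by (simp add: slender_def)
  interpret Z: comm_group baer_specker
    by (rule comm_group_baer_specker)
  note transfer = equiv_L_infinity_omega_1_all_types[OF Z.is_monoid G.is_monoid equiv]
  have "unit_vector n \<noteq> \<one>\<^bsub>baer_specker\<^esub>" for n
    by (auto simp: unit_vector_def fun_eq_iff)
  then have "holds baer_specker series_sentence"
    unfolding Z.holds_series_sentence_iff using dyadic_tails_baer_specker
    by (intro bexI[of _ unit_vector]) auto
  then obtain a where a: "a \<in> UNIV \<rightarrow> carrier G" "\<And>n. a n \<noteq> \<one>\<^bsub>G\<^esub>"
    "\<And>x. \<exists>z. dyadic_tails G a x z"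
    using transfer[OF in_L_series_sentence free_vars_series_sentence]
    unfolding G.holds_series_sentence_iff by blast
  have "no_2_divisible_chain G"
    using transfer[OF in_L_no_chain_sentence free_vars_no_chain_sentence]
      no_2_divisible_chain_baer_specker
    by (simp add: Z.holds_no_chain_sentence_iff G.holds_no_chain_sentence_iff)
  then show False
    using not_slender_if_series_converge[of a G] a slender by auto
qed

end
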